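(* Let $T_0>0$, $A_0>0$, $\beta\in[-1,1]$, $p>1$, $\gamma>0$, and let $\varepsilon_0\in(0,\gamma^{-\frac1{p-1}}]$. Assume that $f\in C^2([0,T_0))$ satisfies $f(t)>0$ for $t\in[0,T_0)$ and $$\begin{cases}f''(t)+b(t)f'(t)\ge\gamma f(t)^p\quad\text{for }t\in[0,T_0),\\ f(0)>\varepsilon_0,\\ f'(0)\ge A_0\varepsilon_0.\end{cases}$$ Then, with $\delta_0=\gamma^{\frac1{p-1}}\varepsilon_0$, we have $$f(t)\ge\varepsilon_0\Bigl(1-\mu(p,b,\beta,A_0)\,\delta_0^{p-1}B(t)\Bigr)^{-\frac2{p-1}}\qquad\text{for }t\in[0,T_0),$$ and $T_0$ is estimated as $$T_0\le B^{-1}\Bigl(\mu(p,b,\beta,A_0)^{-1}\delta_0^{1-p}\Bigr).$$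
   Context: Standing assumption: $b:[0,\infty)\to(0,\infty)$ is smooth and there are constants $b_1,b_2,b_3>0$ such that, for all $t\ge0$, $$b_1(1+t)^{-\beta}\le b(t)\le b_2(1+t)^{-\beta},\qquad |b'(t)|\le b_3(1+t)^{-1}b(t),$$ with $\beta\in[-1,1]$. Set $B(t)=\int_0^t b(\tau)^{-1}d\tau$; this is a strictly increasing bijection of $[0,\infty)$ with inverse $B^{-1}$. For $\beta\in(-1,1]$, $B_4>0$ denotes a fixed constant such that $B^{-1}(\tau)\le B_4(1+\tau)^{1/(1+\beta)}$ for all $\tau\ge0$ (such a constant exists). For $A>0$, $$\mu(p,b,\beta,A)=\min\Bigl\{1,\ \tfrac{p-1}{2}b(0)A,\ \Bigl[\tfrac{2(p+1)}{(p-1)^2}b_1^{-2}\bigl\{2^{\frac1{1+\beta}}(1+B_4)\bigr\}^{\max(0,2\beta)}+\tfrac{2(b_1^{-1}b_3+1)}{p-1}\Bigr]^{-1}\Bigr\},$$ where the factor $\{\cdots\}^{\max(0,2\beta)}$ is interpreted as $1$ if $\beta=-1$. *)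

theory Defs
  imports "HOL-Analysis.Analysis"
begin

text \<open>Derivative relative to \<open>S\<close>; at an endpoint of an interval \<open>S\<close> this is the one-sided derivative.\<close>

definition deriv_on :: "real set \<Rightarrow> (real \<Rightarrow> real) \<Rightarrow> real \<Rightarrow> real" where
  "deriv_on S f t = vector_derivative f (at t within S)"

fun Ck_on :: "nat \<Rightarrow> real set \<Rightarrow> (real \<Rightarrow> real) \<Rightarrow> bool" where
  "Ck_on 0 S f \<longleftrightarrow> continuous_on S f"
| "Ck_on (Suc k) S f \<longleftrightarrow> f differentiable_on S \<and> Ck_on k S (deriv_on S f)"

definition smooth_on :: "real set \<Rightarrow> (real \<Rightarrow> real) \<Rightarrow> bool" where
  "smooth_on S f \<longleftrightarrow> (\<forall>k. Ck_on k S f)"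

definition B_fun :: "(real \<Rightarrow> real) \<Rightarrow> real \<Rightarrow> real" where
  "B_fun b t = integral {0..t} (\<lambda>\<tau>. 1 / b \<tau>)"

definition B_inv :: "(real \<Rightarrow> real) \<Rightarrow> real \<Rightarrow> real" where
  "B_inv b = inv_into {0..} (B_fun b)"

text \<open>The constants \<open>b1\<close>, \<open>b3\<close>, \<open>B4\<close>, on which \<open>\<mu>(p, b, \<beta>, A)\<close> depends implicitly, are
  explicit arguments here. For \<open>\<beta> = -1\<close> the value does not depend on \<open>B4\<close>.\<close>

definition mu :: "real \<Rightarrow> (real \<Rightarrow> real) \<Rightarrow> real \<Rightarrow> real \<Rightarrow> real \<Rightarrow> real \<Rightarrow> real \<Rightarrow> real" where
  "mu p b \<beta> b1 b3 B4 A =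
     Min {1,
          (p - 1) / 2 * b 0 * A,
          inverse
            (2 * (p + 1) / (p - 1)^2 * (1 / b1^2)
               * (if \<beta> = -1 then 1
                  else (2 powr (1 / (1 + \<beta>)) * (1 + B4)) powr (max 0 (2 * \<beta>)))
             + 2 * (b3 / b1 + 1) / (p - 1))}"

end

theory Submission
  imports Defs
begin

text \<open>
  Write \<open>a = 2 / (p - 1)\<close> and \<open>K = \<mu> * \<delta>0 powr (p - 1)\<close>. The claimed lower bound is the profile
  \<open>h = \<epsilon>0 * \<phi> powr (- a)\<close> with \<open>\<phi> = 1 - K * B\<close>. As a function of the new time \<open>B\<close>, its second
  derivative is a constant multiple of \<open>h powr p\<close>, because \<open>a * p = a + 2\<close>. In the original time,
  the leading part of \<open>h''\<close> therefore carries the same power \<open>\<phi> powr (- a - 2)\<close> as \<open>h powr p\<close>, while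
  \<open>b * h'\<close> and the part of \<open>h''\<close> that comes from \<open>b'\<close> carry one more factor \<open>\<phi> \<le> 1\<close>.

  Dividing by this common power, \<open>h\<close> is a subsolution as soon as
  \<open>a * (a + 1) * K / b\<^sup>2 + a * (1 - b' / b\<^sup>2) * \<phi> \<le> 1 / \<mu>\<close> (\<open>profile_subsolution\<close>). Here
  \<open>\<bar>b'\<bar> / b\<^sup>2\<close> is at most \<open>b3 / b1\<close> since \<open>\<beta> \<le> 1\<close>. The only term that may grow in time is
  \<open>K / b\<^sup>2 \<le> K * (1 + t) powr (2 * \<beta>) / b1\<^sup>2\<close> for \<open>\<beta> > 0\<close>; it stays bounded because the profile lives
  only while \<open>B t < 1 / K\<close>, hence for \<open>t\<close> of order at most \<open>K powr (- 1 / (1 + \<beta>))\<close>, and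
  \<open>2 * \<beta> / (1 + \<beta>) \<le> 1\<close> (\<open>weight_bound\<close>). The third entry in the minimum that defines \<open>\<mu>\<close> is the reciprocal of the
  resulting bound, and the second one ensures \<open>h' 0 \<le> A0 * \<epsilon>0\<close>.

  Since \<open>f 0 > h 0\<close> and \<open>f' 0 \<ge> h' 0\<close>, a first-crossing argument (\<open>damped_pos\<close>) gives \<open>f > h\<close> as
  long as both exist. The profile blows up at the time \<open>Ts\<close> with \<open>B Ts = 1 / K\<close>, which exists because
  \<open>B\<close> grows at least logarithmically (\<open>B_fun_ge_ln\<close>); so \<open>f\<close> cannot be continuous at \<open>Ts\<close>, and
  \<open>T0 \<le> Ts\<close>.
\<close>

section \<open>Linear damped inequalities\<close>

text \<open>The integrating factor \<open>exp (\<integral>b)\<close> turns \<open>w' + b * w \<ge> 0\<close> into monotonicity of a product.\<close>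

lemma damped_nonneg:
  fixes b w w' :: "real \<Rightarrow> real"
  assumes "continuous_on {0..s} b" "continuous_on {0..s} w"
    and dw: "\<And>t. 0 < t \<Longrightarrow> t < s \<Longrightarrow> (w has_real_derivative w' t) (at t)"
    and ineq: "\<And>t. 0 < t \<Longrightarrow> t < s \<Longrightarrow> 0 \<le> w' t + b t * w t"
    and "0 \<le> w 0" "0 \<le> t" "t \<le> s"
  shows "0 \<le> w t"
proof -
  define m where "m x = exp (integral {0..x} b)" for x
  have dI: "((\<lambda>x. integral {0..x} b) has_real_derivative b x) (at x within {0..s})"
    if "x \<in> {0..s}" for x
    using integral_has_real_derivative[OF assms(1) that] .
  have "continuous_on {0..s} (\<lambda>x. integral {0..x} b)"
    using dI by (rule DERIV_continuous_on)
  then have cont: "continuous_on {0..s} (\<lambda>x. m x * w x)"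
    unfolding m_def by (intro continuous_intros assms(2))
  have "m 0 * w 0 \<le> m t * w t"
  proof (rule DERIV_nonneg_imp_increasing_open[OF \<open>0 \<le> t\<close>])
    fix x assume x: "0 < x" "x < t"
    then have xs: "x < s" using \<open>t \<le> s\<close> by simp
    have "at x within {0..s} = at x"
      using x xs by (intro at_within_interior) simp
    then have "((\<lambda>x. integral {0..x} b) has_real_derivative b x) (at x)"
      using dI[of x] x xs by simp
    then have "(m has_real_derivative m x * b x) (at x)"
      unfolding m_def by (auto intro!: derivative_eq_intros)
    from DERIV_mult[OF this dw[OF x(1) xs]]
    have "((\<lambda>x. m x * w x) has_real_derivative m x * (w' x + b x * w x)) (at x)"
      by (simp add: algebra_simps)
    moreover have "0 \<le> m x * (w' x + b x * w x)"
      using ineq[OF x(1) xs] by (simp add: m_def)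
    ultimately show "\<exists>y. ((\<lambda>x. m x * w x) has_real_derivative y) (at x) \<and> 0 \<le> y" by blast
  next
    show "continuous_on {0..t} (\<lambda>x. m x * w x)"
      using cont by (rule continuous_on_subset) (use \<open>t \<le> s\<close> in auto)
  qed
  moreover have "0 \<le> m 0 * w 0" "0 < m t" using \<open>0 \<le> w 0\<close> by (auto simp: m_def)
  ultimately show ?thesis by (metis order_trans zero_le_mult_iff not_le)
qed

text \<open>At a first zero \<open>s\<close> of \<open>d\<close> the differential inequality would hold on all of \<open>(0, s)\<close>. Then
  \<open>damped_nonneg\<close>, applied to \<open>d'\<close>, makes \<open>d\<close> nondecreasing up to \<open>s\<close>, contradicting \<open>d 0 > 0\<close>.
  The inequality is required only where \<open>d\<close> is positive: for a difference \<open>d = f - h\<close>, the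
  nonlinear right-hand sides are known to be ordered only there.\<close>

lemma damped_pos:
  fixes b d d' d'' :: "real \<Rightarrow> real"
  assumes cb: "continuous_on {0..<T} b" and cd: "continuous_on {0..<T} d"
    and cd': "continuous_on {0..<T} d'"
    and dd: "\<And>t. 0 < t \<Longrightarrow> t < T \<Longrightarrow> (d has_real_derivative d' t) (at t)"
    and dd': "\<And>t. 0 < t \<Longrightarrow> t < T \<Longrightarrow> (d' has_real_derivative d'' t) (at t)"
    and ineq: "\<And>t. 0 < t \<Longrightarrow> t < T \<Longrightarrow> 0 < d t \<Longrightarrow> 0 \<le> d'' t + b t * d' t"
    and "0 < d 0" "0 \<le> d' 0" and t: "0 \<le> t" "t < T"
  shows "0 < d t"
proof (rule ccontr)
  assume "\<not> 0 < d t"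
  define Z where "Z = {x \<in> {0..t}. d x \<in> {..0}}"
  have "continuous_on {0..t} d" by (rule continuous_on_subset[OF cd]) (use t in auto)
  then have "closed Z" unfolding Z_def
    using continuous_closed_preimage[of "{0..t}" d "{..0}"] by (simp add: vimage_def Int_def)
  moreover have "bounded Z" by (rule bounded_subset[of "{0..t}"]) (auto simp: Z_def)
  moreover have "t \<in> Z" using \<open>\<not> 0 < d t\<close> t by (auto simp: Z_def)
  ultimately obtain s where s: "s \<in> Z" "\<And>x. x \<in> Z \<Longrightarrow> s \<le> x"
    using compact_attains_inf[of Z] by (auto simp: compact_eq_bounded_closed)
  have sT: "0 \<le> s" "s < T" "d s \<le> 0" using s(1) t by (auto simp: Z_def)
  have pos: "0 < d x" if "0 \<le> x" "x < s" for x
    using s(2)[of x] s(1) that by (force simp: Z_def)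
  have sub: "{0..s} \<subseteq> {0..<T}" using sT by auto
  have d'_nonneg: "0 \<le> d' x" if "0 \<le> x" "x \<le> s" for x
    by (rule damped_nonneg[of s b d' d''])
      (use that sT pos ineq dd' \<open>0 \<le> d' 0\<close> continuous_on_subset[OF _ sub] cb cd' in auto)
  have "d 0 \<le> d s"
  proof (rule DERIV_nonneg_imp_increasing_open[OF \<open>0 \<le> s\<close>])
    show "\<exists>y. (d has_real_derivative y) (at x) \<and> 0 \<le> y" if "0 < x" "x < s" for x
      using dd[of x] d'_nonneg[of x] that sT by auto
    show "continuous_on {0..s} d" by (rule continuous_on_subset[OF cd sub])
  qed
  then show False using \<open>0 < d 0\<close> sT by simp
qed

section \<open>The time change \<open>B\<close>\<close>

lemma B_fun_0 [simp]: "B_fun b 0 = 0"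
  by (simp add: B_fun_def)

text \<open>The one-sided neighbourhood \<open>{0..}\<close> includes the endpoint \<open>t = 0\<close>, so that continuity of \<open>B\<close> up
  to \<open>0\<close> follows as well.\<close>

lemma B_fun_has_derivative:
  assumes "continuous_on {0..} b" "\<And>t. 0 \<le> t \<Longrightarrow> 0 < b t" "0 \<le> t"
  shows "(B_fun b has_real_derivative 1 / b t) (at t within {0..})"
proof -
  have "continuous_on {0..t+1} (\<lambda>x. 1 / b x)"
  proof (intro continuous_intros)
    show "continuous_on {0..t+1} b" using assms(1) by (rule continuous_on_subset) auto
    show "\<forall>x\<in>{0..t+1}. b x \<noteq> 0" using assms(2) by force
  qed
  then have "((\<lambda>x. integral {0..x} (\<lambda>x. 1 / b x)) has_real_derivative 1 / b t) (at t within {0..t+1})"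
    by (rule integral_has_real_derivative) (use assms(3) in auto)
  moreover have "at t within {0..t+1} = at t within {0..}"
    by (rule at_within_nhd[where S = "{..<t+1}"]) auto
  ultimately show ?thesis by (simp add: B_fun_def[abs_def])
qed

lemma at_within_atLeast_interior: "a < t \<Longrightarrow> at t within {a..} = at (t::real)"
  by (intro at_within_interior) simp

lemma B_fun_continuous:
  assumes "continuous_on {0..} b" "\<And>t. 0 \<le> t \<Longrightarrow> 0 < b t"
  shows "continuous_on {0..} (B_fun b)"
  by (rule DERIV_continuous_on) (use B_fun_has_derivative[OF assms] in auto)

lemma B_fun_strict_mono:
  assumes "continuous_on {0..} b" "\<And>t. 0 \<le> t \<Longrightarrow> 0 < b t" and "0 \<le> s" "s < t"
  shows "B_fun b s < B_fun b t"
proof (rule DERIV_pos_imp_increasing_open[OF \<open>s < t\<close>])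
  show "\<exists>y. (B_fun b has_real_derivative y) (at x) \<and> 0 < y" if "s < x" "x < t" for x
  proof (intro exI conjI)
    show "(B_fun b has_real_derivative 1 / b x) (at x)"
      using B_fun_has_derivative[OF assms(1,2), of x] that \<open>0 \<le> s\<close>
      by (simp add: at_within_atLeast_interior)
    show "0 < 1 / b x" using assms(2)[of x] that \<open>0 \<le> s\<close> by simp
  qed
  show "continuous_on {s..t} (B_fun b)"
    using B_fun_continuous[OF assms(1,2)] by (rule continuous_on_subset) (use \<open>0 \<le> s\<close> in auto)
qed

text \<open>Compare derivatives: \<open>1 / b \<ge> 1 / (c * (1 + t))\<close>. Linear growth of \<open>b\<close>, the extreme case
  \<open>\<beta> = -1\<close>, is the fastest power growth for which \<open>B\<close> is unbounded.\<close>

lemma B_fun_ge_ln: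
  assumes cb: "continuous_on {0..} b" and pos: "\<And>t. 0 \<le> t \<Longrightarrow> 0 < b t"
    and up: "\<And>t. 0 \<le> t \<Longrightarrow> b t \<le> c * (1 + t)" and "0 < c" "0 \<le> t"
  shows "ln (1 + t) / c \<le> B_fun b t"
proof -
  have "B_fun b 0 - ln (1 + 0) / c \<le> B_fun b t - ln (1 + t) / c"
  proof (rule DERIV_nonneg_imp_increasing_open[OF \<open>0 \<le> t\<close>])
    fix x assume x: "0 < x" "x < t"
    have "(B_fun b has_real_derivative 1 / b x) (at x)"
      using B_fun_has_derivative[OF cb pos, of x] x by (simp add: at_within_atLeast_interior)
    then have "((\<lambda>t. B_fun b t - ln (1 + t) / c) has_real_derivative 1 / b x - 1 / (1 + x) / c) (at x)"
      using x \<open>0 < c\<close> by (auto intro!: derivative_eq_intros)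
    moreover have "1 / (1 + x) / c \<le> 1 / b x"
      using up[of x] pos[of x] x \<open>0 < c\<close> by (simp add: field_simps)
    ultimately show "\<exists>y. ((\<lambda>t. B_fun b t - ln (1 + t) / c) has_real_derivative y) (at x) \<and> 0 \<le> y"
      by (meson diff_ge_0_iff_ge)
  next
    have "continuous_on {0..t} (B_fun b)"
      using B_fun_continuous[OF cb pos] by (rule continuous_on_subset) auto
    then show "continuous_on {0..t} (\<lambda>t. B_fun b t - ln (1 + t) / c)"
      using \<open>0 < c\<close> by (intro continuous_intros) auto
  qed
  then show ?thesis by simp
qed

lemma B_fun_surj:
  assumes cb: "continuous_on {0..} b" and pos: "\<And>t. 0 \<le> t \<Longrightarrow> 0 < b t"
    and up: "\<And>t. 0 \<le> t \<Longrightarrow> b t \<le> c * (1 + t)" and "0 < c" "0 \<le> y"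
  obtains x where "0 \<le> x" "B_fun b x = y"
proof -
  define t where "t = exp (c * y) - 1"
  have t: "0 \<le> t" using assms(4,5) by (simp add: t_def)
  have "y \<le> B_fun b t"
    using B_fun_ge_ln[OF cb pos up \<open>0 < c\<close> t] \<open>0 < c\<close> by (simp add: t_def)
  moreover have "continuous_on {0..t} (B_fun b)"
    using B_fun_continuous[OF cb pos] by (rule continuous_on_subset) auto
  ultimately show ?thesis
    using IVT'[of "B_fun b" 0 y t] t \<open>0 \<le> y\<close> that by auto
qed

lemma B_inv_B_fun:
  assumes "continuous_on {0..} b" "\<And>t. 0 \<le> t \<Longrightarrow> 0 < b t" "0 \<le> t"
  shows "B_inv b (B_fun b t) = t"
proof -
  have "inj_on (B_fun b) {0..}"
    by (rule linorder_inj_onI) (use B_fun_strict_mono[OF assms(1,2)] in \<open>force+\<close>)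
  then show ?thesis using assms(3) by (simp add: B_inv_def)
qed

section \<open>The explicit subsolution\<close>

text \<open>For \<open>\<beta> \<le> 0\<close> the weight \<open>(1 + t) powr (2 * \<beta>)\<close> is at most \<open>1\<close>. For \<open>\<beta> > 0\<close> the bound on \<open>t\<close>
  gives \<open>1 + t \<le> (1 + B4) * (2 / K) powr (1 / (1 + \<beta>))\<close>, so the left-hand side is at most a constant times
  \<open>K\<close> to the power \<open>1 - 2 * \<beta> / (1 + \<beta>) = (1 - \<beta>) / (1 + \<beta>)\<close>, nonnegative exactly when \<open>\<beta> \<le> 1\<close>.\<close>

lemma weight_bound:
  fixes \<beta> K B4 t :: real
  assumes \<beta>: "-1 \<le> \<beta>" "\<beta> \<le> 1" and K: "0 < K" "K \<le> 1" and "0 \<le> t"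
    and B4: "\<beta> > -1 \<Longrightarrow> 0 < B4"
    and tb: "\<beta> > -1 \<Longrightarrow> t \<le> B4 * (1 + 1 / K) powr (1 / (1 + \<beta>))"
  shows "K * (1 + t) powr (2 * \<beta>) \<le>
    (if \<beta> = -1 then 1 else (2 powr (1 / (1 + \<beta>)) * (1 + B4)) powr (max 0 (2 * \<beta>)))"
proof (cases "\<beta> \<le> 0")
  case True
  have "(1 + t) powr (2 * \<beta>) \<le> (1 + t) powr 0"
    by (rule powr_mono) (use True \<open>0 \<le> t\<close> in auto)
  then have "K * (1 + t) powr (2 * \<beta>) \<le> 1 * 1"
    by (intro mult_mono) (use K \<open>0 \<le> t\<close> in auto)
  then show ?thesis using True \<beta> B4 by (auto simp: max_def)
next
  case False
  define e where "e = 1 / (1 + \<beta>)"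
  have e: "0 < e" and B4: "0 < B4" using False B4 by (auto simp: e_def)
  have "1 + 1 / K \<le> 2 / K" using K by (simp add: field_simps)
  then have "(1 + 1 / K) powr e \<le> (2 / K) powr e"
    using e K by (intro powr_mono2) auto
  then have "t \<le> B4 * (2 / K) powr e"
    using tb False B4 by (auto simp: e_def intro: order_trans mult_left_mono)
  moreover have "1 \<le> (2 / K) powr e" using K e by (intro ge_one_powr_ge_zero) auto
  ultimately have "1 + t \<le> (1 + B4) * (2 / K) powr e" by (simp add: algebra_simps)
  also have "\<dots> = (2 powr e * (1 + B4)) * K powr (- e)"
    using K by (simp add: powr_divide powr_minus field_simps)
  finally have "(1 + t) powr (2 * \<beta>) \<le> ((2 powr e * (1 + B4)) * K powr (- e)) powr (2 * \<beta>)"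
    using False \<open>0 \<le> t\<close> by (intro powr_mono2) auto
  also have "\<dots> = (2 powr e * (1 + B4)) powr (2 * \<beta>) * K powr (- e * (2 * \<beta>))"
    using B4 K by (subst powr_mult) (auto simp: powr_powr)
  finally have "K * (1 + t) powr (2 * \<beta>)
      \<le> (2 powr e * (1 + B4)) powr (2 * \<beta>) * (K powr 1 * K powr (- e * (2 * \<beta>)))"
    using K by (simp add: mult.left_commute mult_left_mono)
  also have "K powr 1 * K powr (- e * (2 * \<beta>)) = K powr (1 - e * (2 * \<beta>))"
    by (subst powr_add[symmetric]) simp
  also have "\<dots> \<le> 1"
  proof -
    have "0 \<le> 1 - e * (2 * \<beta>)" using False \<beta> by (simp add: e_def field_simps)
    then show ?thesis using K by (simp add: powr_le1)
  qed
  finally show ?thesis using False B4 by (simp add: e_def mult_left_mono)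
qed

text \<open>The right-hand side is the bracket in the definition of \<open>mu\<close>, \<open>W\<close> being the bound from
  \<open>weight_bound\<close>; \<open>bt\<close>, \<open>b't\<close> and \<open>\<phi>\<close> are the values of \<open>b\<close>, \<open>b'\<close> and \<open>1 - K * B\<close> at one time.\<close>

lemma subsolution_coefficient:
  fixes p K W b1 b3 bt b't \<phi> :: real
  assumes "1 < p" "0 < b1" "0 < b3" "0 < bt"
    and W: "K / bt\<^sup>2 \<le> W / b1\<^sup>2"
    and b't: "\<bar>b't\<bar> / bt\<^sup>2 \<le> b3 / b1"
    and \<phi>: "0 \<le> \<phi>" "\<phi> \<le> 1"
  shows "2 * (p + 1) / (p - 1)\<^sup>2 * (K / bt\<^sup>2) + 2 / (p - 1) * ((1 - b't / bt\<^sup>2) * \<phi>)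
    \<le> 2 * (p + 1) / (p - 1)\<^sup>2 * (1 / b1\<^sup>2) * W + 2 * (b3 / b1 + 1) / (p - 1)"
proof -
  have "- b't / bt\<^sup>2 \<le> \<bar>b't\<bar> / bt\<^sup>2" by (rule divide_right_mono) auto
  then have "(1 - b't / bt\<^sup>2) * \<phi> \<le> (b3 / b1 + 1) * \<phi>"
    using b't \<phi> by (intro mult_right_mono) auto
  also have "\<dots> \<le> (b3 / b1 + 1) * 1"
    using \<phi> assms by (intro mult_left_mono) auto
  finally have "2 / (p - 1) * ((1 - b't / bt\<^sup>2) * \<phi>) \<le> 2 / (p - 1) * (b3 / b1 + 1)"
    using \<open>1 < p\<close> by (intro mult_left_mono) auto
  moreover have "2 * (p + 1) / (p - 1)\<^sup>2 * (K / bt\<^sup>2) \<le> 2 * (p + 1) / (p - 1)\<^sup>2 * (W / b1\<^sup>2)"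
    using \<open>1 < p\<close> W by (intro mult_left_mono) auto
  ultimately show ?thesis by simp
qed

lemma powr_neg_shift:
  fixes x a :: real
  assumes "0 < x"
  shows "x powr (- a - 1) = x powr (- a - 2) * x"
proof -
  have e: "- a - 1 = (- a - 2) + 1" by simp
  show ?thesis unfolding e powr_add using assms by simp
qed

lemma profile_has_derivative:
  fixes B b :: "real \<Rightarrow> real"
  assumes "(B has_real_derivative 1 / b t) (at t)" "K * B t < 1"
  shows "((\<lambda>t. \<epsilon> * (1 - K * B t) powr (- a)) has_real_derivative
    \<epsilon> * a * K * ((1 - K * B t) powr (- a - 1) / b t)) (at t)"
  using assms by (auto intro!: derivative_eq_intros DERIV_fun_powr simp: algebra_simps)

text \<open>The power \<open>\<phi> powr (- a - 2)\<close> of \<open>\<phi> = 1 - K * B\<close> is factored out to match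
  \<open>\<phi> powr (- a * p)\<close>, the power in the nonlinearity when \<open>a = 2 / (p - 1)\<close>.\<close>

lemma profile_has_second_derivative:
  fixes B b :: "real \<Rightarrow> real"
  assumes B: "(B has_real_derivative 1 / b t) (at t)" and b: "(b has_real_derivative b't) (at t)"
    and pos: "0 < b t" and K: "K * B t < 1"
  shows "((\<lambda>t. \<epsilon> * a * K * ((1 - K * B t) powr (- a - 1) / b t)) has_real_derivative
    \<epsilon> * a * K * (1 - K * B t) powr (- a - 2)
      * ((a + 1) * (K / (b t)\<^sup>2) - b't / (b t)\<^sup>2 * (1 - K * B t))) (at t)"
proof -
  define \<phi> where "\<phi> = 1 - K * B t"
  have \<phi>: "0 < \<phi>" using K by (simp add: \<phi>_def)
  have "((\<lambda>t. 1 - K * B t) has_real_derivative - (K / b t)) (at t)"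
    using B by (auto intro!: derivative_eq_intros)
  from DERIV_fun_powr[OF this, of "- a - 1"] \<phi>
  have "((\<lambda>t. (1 - K * B t) powr (- a - 1)) has_real_derivative
      (- a - 1) * \<phi> powr (- a - 2) * - (K / b t)) (at t)"
    by (simp add: \<phi>_def diff_diff_eq)
  from DERIV_divide[OF this b] pos
  have "((\<lambda>t. (1 - K * B t) powr (- a - 1) / b t) has_real_derivative
      ((- a - 1) * \<phi> powr (- a - 2) * - (K / b t) * b t - \<phi> powr (- a - 1) * b't) / (b t * b t)) (at t)"
    by (simp add: \<phi>_def)
  moreover have "((- a - 1) * c * - (K / b t) * b t - c * \<phi> * b't) / (b t * b t)
      = c * ((a + 1) * (K / (b t)\<^sup>2) - b't / (b t)\<^sup>2 * \<phi>)" for c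
    using pos by (simp add: power2_eq_square field_simps)
  ultimately have "((\<lambda>t. (1 - K * B t) powr (- a - 1) / b t) has_real_derivative
      \<phi> powr (- a - 2) * ((a + 1) * (K / (b t)\<^sup>2) - b't / (b t)\<^sup>2 * \<phi>)) (at t)"
    by (simp only: powr_neg_shift[OF \<phi>])
  from DERIV_cmult[OF this, of "\<epsilon> * a * K"] show ?thesis
    by (simp add: \<phi>_def mult.assoc)
qed

text \<open>With \<open>a * p = a + 2\<close>, both sides are multiples of \<open>\<epsilon> * \<phi> powr (- a - 2)\<close>. The left factor is \<open>K\<close>
  times the expression bounded by \<open>M\<close>, and the right factor is \<open>\<gamma> * \<epsilon> powr (p - 1)\<close>. The left-hand
  side of the conclusion is \<open>h'' + b * h'\<close> for the profile \<open>h\<close>.\<close>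

lemma profile_subsolution:
  fixes \<epsilon> \<gamma> p K M bt b't \<phi> :: real
  defines "a \<equiv> 2 / (p - 1)"
  assumes "1 < p" "0 < \<epsilon>" "0 < \<gamma>" "0 < \<phi>" "0 < K" "0 < bt"
    and coeff: "2 * (p + 1) / (p - 1)\<^sup>2 * (K / bt\<^sup>2) + 2 / (p - 1) * ((1 - b't / bt\<^sup>2) * \<phi>) \<le> M"
    and KM: "K * M \<le> \<gamma> * \<epsilon> powr (p - 1)"
  shows "\<epsilon> * a * K * \<phi> powr (- a - 2) * ((a + 1) * (K / bt\<^sup>2) - b't / bt\<^sup>2 * \<phi>)
      + bt * (\<epsilon> * a * K * (\<phi> powr (- a - 1) / bt)) \<le> \<gamma> * (\<epsilon> * \<phi> powr (- a)) powr p"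
proof -
  have ap: "- a * p = - a - 2" using \<open>1 < p\<close> by (simp add: a_def field_simps)
  have aa: "a * (a + 1) = 2 * (p + 1) / (p - 1)\<^sup>2"
    using \<open>1 < p\<close> by (simp add: a_def power2_eq_square divide_simps)
  have "\<phi> powr (- a - 1) = \<phi> powr (- a - 2) * \<phi>"
    using \<open>0 < \<phi>\<close> by (rule powr_neg_shift)
  then have "\<epsilon> * a * K * \<phi> powr (- a - 2) * ((a + 1) * (K / bt\<^sup>2) - b't / bt\<^sup>2 * \<phi>)
      + bt * (\<epsilon> * a * K * (\<phi> powr (- a - 1) / bt))
    = \<epsilon> * \<phi> powr (- a - 2) * (K * (a * (a + 1) * (K / bt\<^sup>2) + a * ((1 - b't / bt\<^sup>2) * \<phi>)))"
    using \<open>0 < bt\<close> by (simp add: algebra_simps)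
  also have "\<dots> \<le> \<epsilon> * \<phi> powr (- a - 2) * (K * M)"
  proof (intro mult_left_mono)
    show "a * (a + 1) * (K / bt\<^sup>2) + a * ((1 - b't / bt\<^sup>2) * \<phi>) \<le> M"
      unfolding aa unfolding a_def by (fact coeff)
  qed (use \<open>0 < K\<close> \<open>0 < \<epsilon>\<close> in auto)
  also have "\<dots> \<le> \<epsilon> * \<phi> powr (- a - 2) * (\<gamma> * \<epsilon> powr (p - 1))"
    using KM \<open>0 < \<epsilon>\<close> by (intro mult_left_mono) auto
  also have "\<dots> = \<gamma> * (\<epsilon> powr p * \<phi> powr (- a * p))"
    unfolding ap using \<open>0 < \<epsilon>\<close> powr_add[of \<epsilon> 1 "p - 1"] by simp
  also have "\<dots> = \<gamma> * (\<epsilon> * \<phi> powr (- a)) powr p"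
    using \<open>0 < \<epsilon>\<close> by (simp add: powr_mult powr_powr)
  finally show ?thesis .
qed

section \<open>Lower bound and lifespan\<close>

theorem proposition2p3:
  fixes b f :: "real \<Rightarrow> real"
    and b1 b2 b3 B4 \<beta> T0 A0 p \<gamma> \<epsilon>0 \<delta>0 :: real
  assumes beta: "\<beta> \<in> {-1..1}"
    and b_smooth: "smooth_on {0..} b"
    and b_pos: "\<And>t. t \<ge> 0 \<Longrightarrow> b t > 0"
    and consts_pos: "b1 > 0" "b2 > 0" "b3 > 0"
    and b_lower: "\<And>t. t \<ge> 0 \<Longrightarrow> b1 * (1 + t) powr (- \<beta>) \<le> b t"
    and b_upper: "\<And>t. t \<ge> 0 \<Longrightarrow> b t \<le> b2 * (1 + t) powr (- \<beta>)"
    and b_deriv: "\<And>t. t \<ge> 0 \<Longrightarrow> \<bar>deriv_on {0..} b t\<bar> \<le> b3 * (1 / (1 + t)) * b t"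
    and B4_pos: "\<beta> > -1 \<Longrightarrow> B4 > 0"
    and B4_bound: "\<And>\<tau>. \<beta> > -1 \<Longrightarrow> \<tau> \<ge> 0 \<Longrightarrow> B_inv b \<tau> \<le> B4 * (1 + \<tau>) powr (1 / (1 + \<beta>))"
    and params: "T0 > 0" "A0 > 0" "p > 1" "\<gamma> > 0"
    and eps: "\<epsilon>0 \<in> {0<..\<gamma> powr (- (1 / (p - 1)))}"
    and delta: "\<delta>0 = \<gamma> powr (1 / (p - 1)) * \<epsilon>0"
    and f_C2: "Ck_on 2 {0..<T0} f"
    and f_pos: "\<And>t. t \<in> {0..<T0} \<Longrightarrow> f t > 0"
    and f_ineq: "\<And>t. t \<in> {0..<T0} \<Longrightarrow>
      deriv_on {0..<T0} (deriv_on {0..<T0} f) t + b t * deriv_on {0..<T0} f t \<ge> \<gamma> * f t powr p"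
    and f_init: "f 0 > \<epsilon>0"
    and f'_init: "deriv_on {0..<T0} f 0 \<ge> A0 * \<epsilon>0"
  shows "(\<forall>t\<in>{0..<T0}.
            f t \<ge> \<epsilon>0 * (1 - mu p b \<beta> b1 b3 B4 A0 * \<delta>0 powr (p - 1) * B_fun b t)
                     powr (- (2 / (p - 1))))
         \<and> T0 \<le> B_inv b (inverse (mu p b \<beta> b1 b3 B4 A0) * \<delta>0 powr (1 - p))"
proof -
  let ?S = "{0..<T0}"
  define f' where "f' = deriv_on ?S f"
  define f'' where "f'' = deriv_on ?S f'"
  define b' where "b' = deriv_on {0..} b"
  define B where "B = B_fun b"
  have b_diff: "b differentiable_on {0..}"
    using b_smooth unfolding smooth_on_def by (metis Ck_on.simps(2))
  have cb: "continuous_on {0..} b"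
    using b_diff by (rule differentiable_imp_continuous_on)
  have db: "(b has_real_derivative b' t) (at t)" if "0 < t" for t
  proof -
    have "(b has_real_derivative b' t) (at t within {0..})"
      using b_diff that unfolding b'_def deriv_on_def differentiable_on_def
      by (simp add: has_real_derivative_iff_has_vector_derivative vector_derivative_works)
    then show ?thesis using that by (simp add: at_within_atLeast_interior)
  qed
  have dB: "(B has_real_derivative 1 / b t) (at t)" if "0 < t" for t
    using B_fun_has_derivative[OF cb b_pos, of t] that
    by (simp add: B_def at_within_atLeast_interior)
  have cB: "continuous_on {0..} B" unfolding B_def by (rule B_fun_continuous[OF cb b_pos])
  have B_mono: "B s < B t" if "0 \<le> s" "s < t" for s t
    unfolding B_def by (rule B_fun_strict_mono[OF cb b_pos that])
  have B0: "B 0 = 0" by (simp add: B_def)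

  have f_diff: "f differentiable_on ?S" "f' differentiable_on ?S"
    using f_C2 by (simp_all add: numeral_2_eq_2 f'_def)
  have cf: "continuous_on ?S f" "continuous_on ?S f'"
    using f_diff by (auto intro: differentiable_imp_continuous_on)
  have int: "at t within ?S = at t" if "0 < t" "t < T0" for t
    using that by (intro at_within_interior) simp
  have df: "(f has_real_derivative f' t) (at t)" if "0 < t" "t < T0" for t
  proof -
    have "(f has_real_derivative f' t) (at t within ?S)"
      using f_diff(1) that unfolding f'_def deriv_on_def differentiable_on_def
      by (simp add: has_real_derivative_iff_has_vector_derivative vector_derivative_works)
    then show ?thesis using int[OF that] by simp
  qed
  have df': "(f' has_real_derivative f'' t) (at t)" if "0 < t" "t < T0" for t
  proof -
    have "(f' has_real_derivative f'' t) (at t within ?S)"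
      using f_diff(2) that unfolding f''_def deriv_on_def differentiable_on_def
      by (simp add: has_real_derivative_iff_has_vector_derivative vector_derivative_works)
    then show ?thesis using int[OF that] by simp
  qed

  define W where "W = (if \<beta> = -1 then 1
    else (2 powr (1 / (1 + \<beta>)) * (1 + B4)) powr (max 0 (2 * \<beta>)))"
  define M where "M = 2 * (p + 1) / (p - 1)\<^sup>2 * (1 / b1\<^sup>2) * W + 2 * (b3 / b1 + 1) / (p - 1)"
  define \<mu> where "\<mu> = mu p b \<beta> b1 b3 B4 A0"
  define D where "D = \<delta>0 powr (p - 1)"
  define K where "K = \<mu> * D"
  define a where "a = 2 / (p - 1)"
  have a: "0 < a" using params by (simp add: a_def)
  have "0 \<le> W" by (simp add: W_def)
  then have M: "0 < M"
    unfolding M_def using params consts_pos by (intro add_nonneg_pos divide_pos_pos mult_pos_pos add_pos_pos) auto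
  have mu_eq: "\<mu> = Min {1, (p - 1) / 2 * b 0 * A0, inverse M}"
    by (simp add: \<mu>_def mu_def M_def W_def)
  have \<mu>: "0 < \<mu>" "\<mu> \<le> 1" "\<mu> \<le> (p - 1) / 2 * b 0 * A0" "\<mu> \<le> inverse M"
    unfolding mu_eq using params b_pos[of 0] M by auto
  have \<epsilon>: "0 < \<epsilon>0" "\<epsilon>0 \<le> \<gamma> powr (- (1 / (p - 1)))" using eps by auto
  \<comment> \<open>\<open>\<delta>0 \<le> 1\<close> is what the upper limit on \<open>\<epsilon>0\<close> means; with \<open>\<mu> \<le> 1\<close> it gives \<open>K \<le> 1\<close>, needed in \<open>weight_bound\<close>.\<close>
  have "\<delta>0 \<le> \<gamma> powr (1 / (p - 1)) * \<gamma> powr (- (1 / (p - 1)))"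
    unfolding delta using \<epsilon>(2) by (rule mult_left_mono) simp
  also have "\<dots> = 1" using params by (simp flip: powr_add)
  finally have \<delta>: "0 < \<delta>0" "\<delta>0 \<le> 1" using delta \<epsilon> params by auto
  have D: "0 < D" "D \<le> 1" using \<delta> params by (auto simp: D_def powr_le1)
  have D_eq: "D = \<gamma> * \<epsilon>0 powr (p - 1)"
    using params \<epsilon> by (simp add: D_def delta powr_mult powr_powr)
  have K: "0 < K" "K \<le> 1" "K \<le> \<mu>"
    using \<mu> D by (auto simp: K_def mult_le_one mult_left_le)
  have "\<mu> * M \<le> 1" using \<mu>(4) M by (simp add: field_simps)
  then have KM: "K * M \<le> D" using D mult_right_mono[of "\<mu> * M" 1 D] by (simp add: K_def mult_ac)

  have up: "b t \<le> b2 * (1 + t)" if "0 \<le> t" for t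
  proof -
    have "(1 + t) powr (- \<beta>) \<le> (1 + t) powr 1" using beta that by (intro powr_mono) auto
    then have "b2 * (1 + t) powr (- \<beta>) \<le> b2 * (1 + t)"
      using consts_pos that by (simp add: mult_left_mono)
    with b_upper[OF that] show ?thesis by linarith
  qed
  obtain Ts where Ts: "0 \<le> Ts" "B Ts = 1 / K"
    using B_fun_surj[OF cb b_pos up, of "1 / K"] consts_pos K by (auto simp: B_def)
  have KB: "K * B t < 1" if "0 \<le> t" "t < Ts" for t
    using B_mono[OF that] Ts K by (simp add: field_simps)
  have B_nonneg: "0 \<le> B t" if "0 \<le> t" for t
    using B_mono[of 0 t] B0 that by (cases "t = 0") auto
  have inv: "B_inv b (B t) = t" if "0 \<le> t" for t
    unfolding B_def by (rule B_inv_B_fun[OF cb b_pos that])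

  have sub: "\<epsilon>0 * a * K * (1 - K * B t) powr (- a - 2)
        * ((a + 1) * (K / (b t)\<^sup>2) - b' t / (b t)\<^sup>2 * (1 - K * B t))
      + b t * (\<epsilon>0 * a * K * ((1 - K * B t) powr (- a - 1) / b t))
      \<le> \<gamma> * (\<epsilon>0 * (1 - K * B t) powr (- a)) powr p" if t: "0 \<le> t" "t < Ts" for t
    unfolding a_def
  proof (rule profile_subsolution)
    show "K * M \<le> \<gamma> * \<epsilon>0 powr (p - 1)" using KM D_eq by simp
    have lower: "b1 * (1 + t) powr (- \<beta>) \<le> b t" using b_lower t by blast
    have "t \<le> B4 * (1 + 1 / K) powr (1 / (1 + \<beta>))" if "-1 < \<beta>"
    proof -
      have "B t \<le> 1 / K" using KB[OF t] K by (simp add: field_simps)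
      then have "B4 * (1 + B t) powr (1 / (1 + \<beta>)) \<le> B4 * (1 + 1 / K) powr (1 / (1 + \<beta>))"
        using that B4_pos B_nonneg[OF t(1)] by (intro mult_left_mono powr_mono2) auto
      then show ?thesis using B4_bound[OF that B_nonneg[OF t(1)]] inv[OF t(1)] by simp
    qed
    then have "K * (1 + t) powr (2 * \<beta>) \<le> W"
      unfolding W_def using beta K t B4_pos by (intro weight_bound) auto
    moreover have "K / (b t)\<^sup>2 \<le> K * (1 + t) powr (2 * \<beta>) / b1\<^sup>2"
    proof -
      have "K / (b t)\<^sup>2 \<le> K / (b1 * (1 + t) powr (- \<beta>))\<^sup>2"
        using lower b_pos[OF t(1)] K consts_pos t
        by (intro divide_left_mono power_mono mult_pos_pos zero_less_power) auto
      also have "\<dots> = K * (1 + t) powr (2 * \<beta>) / b1\<^sup>2"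
        using t by (simp add: power_mult_distrib powr_minus power2_eq_square field_simps flip: powr_add)
      finally show ?thesis .
    qed
    ultimately have W: "K / (b t)\<^sup>2 \<le> W / b1\<^sup>2"
      using consts_pos by (meson divide_right_mono order_trans zero_le_power2)
    have "\<bar>b' t\<bar> * b1 \<le> b3 * (b t)\<^sup>2"
    proof -
      have "(1 + t) powr - 1 \<le> (1 + t) powr (- \<beta>)" using beta t by (intro powr_mono) auto
      then have "b1 * (1 + t) powr - 1 \<le> b1 * (1 + t) powr (- \<beta>)"
        using consts_pos by (intro mult_left_mono) auto
      then have "b1 * (1 / (1 + t)) \<le> b1 * (1 + t) powr (- \<beta>)"
        using t by (simp add: powr_neg_one)
      then have "b1 * (1 / (1 + t)) \<le> b t" using lower by linarith
      then have "(b3 * b t) * (b1 * (1 / (1 + t))) \<le> (b3 * b t) * b t"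
        using consts_pos b_pos[OF t(1)] by (intro mult_left_mono) auto
      moreover have "\<bar>b' t\<bar> * b1 \<le> b3 * (1 / (1 + t)) * b t * b1"
        using b_deriv[OF t(1)] consts_pos unfolding b'_def by (intro mult_right_mono) auto
      ultimately show ?thesis by (simp add: power2_eq_square mult_ac)
    qed
    then have "\<bar>b' t\<bar> / (b t)\<^sup>2 \<le> b3 / b1"
      using consts_pos b_pos[OF t(1)] by (simp add: field_simps)
    with W show "2 * (p + 1) / (p - 1)\<^sup>2 * (K / (b t)\<^sup>2)
        + 2 / (p - 1) * ((1 - b' t / (b t)\<^sup>2) * (1 - K * B t)) \<le> M"
      unfolding M_def
      using params consts_pos b_pos[OF t(1)] KB[OF t] B_nonneg[OF t(1)] K
      by (intro subsolution_coefficient) auto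
  qed (use params \<epsilon> KB[OF t] K b_pos[OF t(1)] in auto)

  have lower: "\<epsilon>0 * (1 - K * B t) powr (- a) < f t" if t: "0 \<le> t" "t < T0" "t < Ts" for t
  proof -
    define T where "T = min T0 Ts"
    define d where "d t = f t - \<epsilon>0 * (1 - K * B t) powr (- a)" for t
    define d' where "d' t = f' t - \<epsilon>0 * a * K * ((1 - K * B t) powr (- a - 1) / b t)" for t
    define d'' where "d'' t = f'' t - \<epsilon>0 * a * K * (1 - K * B t) powr (- a - 2)
      * ((a + 1) * (K / (b t)\<^sup>2) - b' t / (b t)\<^sup>2 * (1 - K * B t))" for t
    have sub_T: "{0..<T} \<subseteq> {0..}" "{0..<T} \<subseteq> ?S" by (auto simp: T_def)
    have cT: "continuous_on {0..<T} b" "continuous_on {0..<T} B"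
      "continuous_on {0..<T} f" "continuous_on {0..<T} f'"
      using cb cB cf sub_T by (auto intro: continuous_on_subset)
    have ne: "1 - K * B t \<noteq> 0" "b t \<noteq> 0" if "t \<in> {0..<T}" for t
      using KB[of t] b_pos[of t] that by (auto simp: T_def)
    have "0 < d t"
    proof (rule damped_pos[of T b d d' d''])
      show "continuous_on {0..<T} b" by fact
      show "continuous_on {0..<T} d" "continuous_on {0..<T} d'"
        unfolding d_def d'_def using ne by (auto intro!: continuous_intros cT)
      show "0 < d 0" using f_init by (simp add: d_def B0)
      \<comment> \<open>The second entry in the minimum orders the initial slopes.\<close>
      have "a * K \<le> b 0 * A0"
      proof -
        have "a * K \<le> a * ((p - 1) / 2 * b 0 * A0)"
          using \<mu>(3) K(3) a by (intro mult_left_mono) auto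
        also have "\<dots> = b 0 * A0" using params by (simp add: a_def)
        finally show ?thesis .
      qed
      then have "a * K / b 0 \<le> A0" using b_pos[of 0] by (simp add: field_simps)
      then have "\<epsilon>0 * (a * K / b 0) \<le> \<epsilon>0 * A0" using \<epsilon> by (intro mult_left_mono) auto
      then show "0 \<le> d' 0" using f'_init by (simp add: d'_def f'_def B0 mult_ac)
      fix t assume t: "0 < t" "t < T"
      then have t0: "t < T0" "t < Ts" by (auto simp: T_def)
      show "(d has_real_derivative d' t) (at t)"
        unfolding d_def d'_def using t t0
        by (intro DERIV_diff df profile_has_derivative dB KB) auto
      show "(d' has_real_derivative d'' t) (at t)"
        unfolding d'_def d''_def using t t0
        by (intro DERIV_diff df' profile_has_second_derivative dB db b_pos KB) auto
      assume "0 < d t"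
      then have "\<gamma> * (\<epsilon>0 * (1 - K * B t) powr (- a)) powr p \<le> \<gamma> * f t powr p"
        using \<epsilon> params by (intro mult_left_mono powr_mono2) (auto simp: d_def)
      then show "0 \<le> d'' t + b t * d' t"
        using sub[of t] f_ineq[of t] t t0
        by (simp add: d'_def d''_def f''_def f'_def right_diff_distrib)
    qed (use t in \<open>auto simp: T_def\<close>)
    then show ?thesis by (simp add: d_def)
  qed

  have T0_le: "T0 \<le> Ts"
  proof (rule ccontr)
    assume "\<not> T0 \<le> Ts"
    then have lt: "Ts < T0" by simp
    have "Ts \<noteq> 0" using Ts B0 K by auto
    then have Ts_pos: "0 < Ts" using Ts by simp
    then have cl: "closure {0..<Ts} = {0..Ts}" by simp
    have KB_le: "K * B t \<le> 1" if "t \<in> {0..Ts}" for t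
      using that KB[of t] Ts K by (cases "t = Ts") auto
    have cTs: "continuous_on {0..Ts} f" "continuous_on {0..Ts} B"
      using cf cB lt by (auto intro: continuous_on_subset)
    \<comment> \<open>Multiplying by \<open>(1 - K * B) powr a\<close> turns the blow-up of the profile into a limit at \<open>Ts\<close>:
      this product is at least \<open>\<epsilon>0\<close> before \<open>Ts\<close> and vanishes there.\<close>
    have "continuous_on {0..Ts} (\<lambda>t. f t * (1 - K * B t) powr a)"
      using a KB_le by (intro continuous_intros continuous_on_powr' cTs) auto
    moreover have "\<epsilon>0 \<le> f t * (1 - K * B t) powr a" if "t \<in> {0..<Ts}" for t
    proof -
      have "0 < 1 - K * B t" using KB[of t] that by auto
      then show ?thesis
        using lower[of t] that lt by (simp add: powr_minus field_simps)
    qed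
    ultimately have "\<epsilon>0 \<le> f Ts * (1 - K * B Ts) powr a"
      using continuous_ge_on_closure[of "{0..<Ts}" "\<lambda>t. f t * (1 - K * B t) powr a" Ts \<epsilon>0]
      unfolding cl using Ts by auto
    then show False using Ts K \<epsilon> by simp
  qed
  have "1 / K = inverse \<mu> * \<delta>0 powr (1 - p)"
    using \<delta> by (simp add: K_def D_def powr_diff field_simps)
  then have "B_inv b (inverse \<mu> * \<delta>0 powr (1 - p)) = Ts"
    using inv[OF Ts(1)] Ts(2) by simp
  then show ?thesis
    using T0_le lower by (force simp: K_def D_def \<mu>_def a_def B_def intro: less_imp_le)
qed

end
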